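(* For any $2n\times 2n$ complex unitary matrix $U$, there exist a $2n\times 2n$ real orthogonal matrix $O$, a complexified $n\times n$ quaternionic unitary matrix $Q\in\{[W]_{\mathbb{C}} : W\in\mathbb{H}^{n\times n},\ W^DW=I_n\}$, and an $n\times n$ unitary diagonal matrix $D=\operatorname{diag}(e^{i\theta_1},\dots,e^{i\theta_n})$ such that $$U = O\begin{bmatrix} D & 0\\ 0 & D\end{bmatrix}Q.$$ Here $\theta_l\in[0,\frac{\pi}{2})$ for all $l$, and $D$ is unique up to permutation of the diagonal elements.
   Context: $\mathbb{H}$ denotes the real quaternions with imaginary units $i,j,k$. For a quaternionic matrix $W$, $W^D$ is the quaternionic conjugate transpose, $(W^D)_{ab}=\overline{W_{ba}}$. The complexify map $[\,\cdot\,]_{\mathbb{C}}:\mathbb{H}^{n\times n}\to\mathbb{C}^{2n\times 2n}$ sends $Y=Y_0+iY_1+jY_2+kY_3$ (with $Y_0,\dots,Y_3$ real matrices) to $$[Y]_{\mathbb{C}}=\begin{bmatrix} Y_0+iY_1 & Y_2+iY_3\\ -Y_2+iY_3 & Y_0-iY_1\end{bmatrix}.$$ *)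

theory Defs
  imports
    Complex_Main
    "HOL-Combinatorics.Permutations"
    "Jordan_Normal_Form.Matrix"
    "Jordan_Normal_Form.Schur_Decomposition"
begin

text \<open>The constructor term \<open>Quat a b c d\<close> stands for a + i b + j c + k d.\<close>

datatype quat = Quat (quat_re: real) (quat_i: real) (quat_j: real) (quat_k: real)

lemma quat_eq_iff:
  "p = q \<longleftrightarrow> quat_re p = quat_re q \<and> quat_i p = quat_i q \<and> quat_j p = quat_j q \<and> quat_k p = quat_k q"
  by (cases p; cases q) auto

instantiation quat :: ring_1
begin

definition zero_quat :: quat where "zero_quat = Quat 0 0 0 0"

definition one_quat :: quat where "one_quat = Quat 1 0 0 0"

definition plus_quat :: "quat \<Rightarrow> quat \<Rightarrow> quat" where
  "plus_quat p q =
     Quat (quat_re p + quat_re q) (quat_i p + quat_i q) (quat_j p + quat_j q) (quat_k p + quat_k q)"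

definition uminus_quat :: "quat \<Rightarrow> quat" where
  "uminus_quat p = Quat (- quat_re p) (- quat_i p) (- quat_j p) (- quat_k p)"

definition minus_quat :: "quat \<Rightarrow> quat \<Rightarrow> quat" where
  "minus_quat p q =
     Quat (quat_re p - quat_re q) (quat_i p - quat_i q) (quat_j p - quat_j q) (quat_k p - quat_k q)"

definition times_quat :: "quat \<Rightarrow> quat \<Rightarrow> quat" where
  "times_quat p q = Quat
     (quat_re p * quat_re q - quat_i p * quat_i q - quat_j p * quat_j q - quat_k p * quat_k q)
     (quat_re p * quat_i q + quat_i p * quat_re q + quat_j p * quat_k q - quat_k p * quat_j q)
     (quat_re p * quat_j q - quat_i p * quat_k q + quat_j p * quat_re q + quat_k p * quat_i q)
     (quat_re p * quat_k q + quat_i p * quat_j q - quat_j p * quat_i q + quat_k p * quat_re q)"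

instance
  by standard
    (simp_all add: quat_eq_iff zero_quat_def one_quat_def plus_quat_def uminus_quat_def
      minus_quat_def times_quat_def algebra_simps)

end

lemma hamilton_relations:
  "Quat 0 1 0 0 * Quat 0 1 0 0 = - 1"
  "Quat 0 0 1 0 * Quat 0 0 1 0 = - 1"
  "Quat 0 0 0 1 * Quat 0 0 0 1 = - 1"
  "Quat 0 1 0 0 * Quat 0 0 1 0 * Quat 0 0 0 1 = - 1"
  by (simp_all add: quat_eq_iff one_quat_def uminus_quat_def times_quat_def)

definition quat_cnj :: "quat \<Rightarrow> quat" where
  "quat_cnj q = Quat (quat_re q) (- quat_i q) (- quat_j q) (- quat_k q)"

text \<open>The library's \<^const>\<open>mat_adjoint\<close> needs a field, so it does not apply to quaternionic matrices.\<close>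

definition quat_adjoint :: "quat mat \<Rightarrow> quat mat" where
  "quat_adjoint W = mat (dim_col W) (dim_row W) (\<lambda>(a, b). quat_cnj (W $$ (b, a)))"

definition complexify :: "quat mat \<Rightarrow> complex mat" where
  "complexify Y = four_block_mat
     (map_mat (\<lambda>q. Complex (quat_re q) (quat_i q)) Y)
     (map_mat (\<lambda>q. Complex (quat_j q) (quat_k q)) Y)
     (map_mat (\<lambda>q. Complex (- quat_j q) (quat_k q)) Y)
     (map_mat (\<lambda>q. Complex (quat_re q) (- quat_i q)) Y)"

definition complex_unitary_mats :: "nat \<Rightarrow> complex mat set" where
  "complex_unitary_mats m = {U \<in> carrier_mat m m. mat_adjoint U * U = 1\<^sub>m m}"

definition real_orthogonal_mats :: "nat \<Rightarrow> real mat set" where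
  "real_orthogonal_mats m = {R \<in> carrier_mat m m. transpose_mat R * R = 1\<^sub>m m}"

definition complexified_quat_unitary_mats :: "nat \<Rightarrow> complex mat set" where
  "complexified_quat_unitary_mats n =
     {complexify W |W. W \<in> carrier_mat n n \<and> quat_adjoint W * W = 1\<^sub>m n}"

definition phase_diag :: "nat \<Rightarrow> (nat \<Rightarrow> real) \<Rightarrow> complex mat" where
  "phase_diag n \<theta> = mat_diag n (\<lambda>l. exp (\<i> * complex_of_real (\<theta> l)))"

text \<open>Diagonal indices are \<open>0, \<dots>, n - 1\<close>; the values of \<open>\<theta>\<close> elsewhere are irrelevant.\<close>

definition is_decomposition ::
  "nat \<Rightarrow> complex mat \<Rightarrow> real mat \<Rightarrow> (nat \<Rightarrow> real) \<Rightarrow> complex mat \<Rightarrow> bool" where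
  "is_decomposition n U R \<theta> Q \<longleftrightarrow>
     R \<in> real_orthogonal_mats (2 * n) \<and>
     (\<forall>l<n. \<theta> l \<in> {0..<pi / 2}) \<and>
     Q \<in> complexified_quat_unitary_mats n \<and>
     U = map_mat complex_of_real R *
         four_block_mat (phase_diag n \<theta>) (0\<^sub>m n n) (0\<^sub>m n n) (phase_diag n \<theta>) * Q"

end

theory Submission
  imports Defs
begin

text \<open>
  With \<open>J = [[0, I], [-I, 0]]\<close>, the complexified quaternionic unitary matrices are the unitary \<open>Q\<close>
  satisfying \<open>Q J Q\<^sup>T = J\<close>. A decomposition \<open>U = O (D \<oplus> D) Q\<close> therefore gives
  \<open>U J U\<^sup>T = O [[0, D\<^sup>2], [-D\<^sup>2, 0]] O\<^sup>T\<close>. Squaring, the eigenvalues of \<open>(U J U\<^sup>T)\<^sup>2\<close> are the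
  \<open>-exp (4 i \<theta>\<^sub>l)\<close>, each doubled; as \<open>4 \<theta>\<^sub>l \<in> [0, 2 \<pi>)\<close> they determine the angles up to order.

  Conversely, \<open>M = U J U\<^sup>T\<close> is antisymmetric and unitary, so \<open>M\<^sup>2\<close> is symmetric and unitary and its
  eigenspaces are closed under conjugation, hence spanned by real vectors. A real unit eigenvector \<open>r\<close>
  with \<open>M\<^sup>2 r = -z\<^sup>2 r\<close> yields the real unit vector \<open>s = -cnj z M r\<close>, orthogonal to \<open>r\<close>, with
  \<open>M r = -z s\<close> and \<open>M s = z r\<close>. Splitting off such pairs successively produces \<open>O\<close>, and then
  \<open>Q = (D \<oplus> D)\<^sup>-\<^sup>1 O\<^sup>T U\<close> is unitary and preserves \<open>J\<close>.
\<close>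

subsection \<open>Eigenvectors in the range of a commuting projection\<close>

text \<open>Gives access to the homomorphism rules for \<open>map_mat\<close> and
  \<open>map_vec\<close> with entrywise conjugation.\<close>

interpretation cnj: inj_comm_ring_hom cnj
  by unfold_locales (auto simp: complex_eq_iff)

definition mat_trace :: "'a :: comm_ring_1 mat \<Rightarrow> 'a" where
  "mat_trace A = (\<Sum>i<dim_row A. A $$ (i, i))"

lemma mat_trace_add:
  assumes "A \<in> carrier_mat m m" "B \<in> carrier_mat m m"
  shows "mat_trace (A + B) = mat_trace A + mat_trace B"
  using assms by (auto simp: mat_trace_def sum.distrib)

lemma mat_trace_minus:
  assumes "A \<in> carrier_mat m m" "B \<in> carrier_mat m m"
  shows "mat_trace (A - B) = mat_trace A - mat_trace B"
  using assms by (auto simp: mat_trace_def sum_subtractf)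

lemma mat_trace_smult: "A \<in> carrier_mat m m \<Longrightarrow> mat_trace (c \<cdot>\<^sub>m A) = c * mat_trace A"
  by (auto simp: mat_trace_def sum_distrib_left)

lemma mat_trace_one: "mat_trace (1\<^sub>m m) = of_nat m"
  by (simp add: mat_trace_def)

lemma mat_trace_mult_commute:
  assumes "A \<in> carrier_mat m p" "B \<in> carrier_mat p m"
  shows "mat_trace (A * B) = mat_trace (B * A)"
proof -
  have "mat_trace (A * B) = (\<Sum>i<m. \<Sum>j<p. A $$ (i, j) * B $$ (j, i))"
    using assms by (auto simp: mat_trace_def scalar_prod_def atLeast0LessThan)
  also have "\<dots> = (\<Sum>j<p. \<Sum>i<m. B $$ (j, i) * A $$ (i, j))"
    by (subst sum.swap) (simp add: mult.commute)
  also have "\<dots> = mat_trace (B * A)"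
    using assms by (auto simp: mat_trace_def scalar_prod_def atLeast0LessThan)
  finally show ?thesis .
qed

text \<open>Schur triangularisation: the trace is invariant under similarity, and the diagonal of
  the triangular form lists the roots of the characteristic polynomial, all of which are
  \<open>c\<close>.\<close>

lemma mat_trace_single_eigenvalue:
  fixes A :: "complex mat"
  assumes A: "A \<in> carrier_mat m m" and ev: "\<And>k. eigenvalue A k \<Longrightarrow> k = c"
  shows "mat_trace A = of_nat m * c"
proof -
  obtain es where es: "char_poly A = (\<Prod>a\<leftarrow>es. [:- a, 1:])" and len: "length es = m"
    using char_poly_factorized[OF A] by blast
  have all_c: "e = c" if "e \<in> set es" for e
  proof (rule ev)
    show "eigenvalue A e"
      using that unfolding eigenvalue_root_char_poly[OF A] es poly_prod_list
      by (auto simp: prod_list_zero_iff image_iff intro!: bexI[of _ e])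
  qed
  obtain B P Q where "schur_decomposition A es = (B, P, Q)"
    by (cases "schur_decomposition A es") auto
  from schur_decomposition[OF A es this]
  have sim: "similar_mat_wit A B P Q" and diag: "diag_mat B = es"
    by auto
  from similar_mat_witD2[OF A sim]
  have carr: "B \<in> carrier_mat m m" "P \<in> carrier_mat m m" "Q \<in> carrier_mat m m"
    and QP: "Q * P = 1\<^sub>m m" and dec: "A = P * B * Q"
    by auto
  have "mat_trace A = mat_trace (Q * (P * B))"
    unfolding dec using carr by (intro mat_trace_mult_commute[of _ m m]) auto
  also have "Q * (P * B) = Q * P * B"
    using carr by (simp add: assoc_mult_mat[of _ m m _ m _ m])
  also have "\<dots> = B"
    using QP carr by simp
  also have "mat_trace B = (\<Sum>i<m. es ! i)"
    using carr by (auto simp: mat_trace_def diag_mat_def simp flip: diag intro!: sum.cong)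
  also have "\<dots> = (\<Sum>i<m. c)"
    using all_c len by (intro sum.cong) auto
  also have "\<dots> = of_nat m * c"
    by simp
  finally show ?thesis .
qed

text \<open>The range of \<open>P\<close> is invariant under \<open>N\<close> and nonzero because
  the trace of \<open>P\<close> is, so \<open>N\<close> has an eigenvector in it. No basis of the
  range is chosen: the restriction of \<open>N\<close> is extended to an operator on the whole
  space.\<close>

lemma eigenvector_in_range:
  fixes N P :: "complex mat"
  assumes N: "N \<in> carrier_mat m m" and P: "P \<in> carrier_mat m m"
    and idem: "P * P = P" and comm: "P * N = N * P" and tr: "mat_trace P \<noteq> 0"
  obtains v k where "v \<in> carrier_vec m" "v \<noteq> 0\<^sub>v m" "P *\<^sub>v v = v" "N *\<^sub>v v = k \<cdot>\<^sub>v v"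
proof -
  \<comment> \<open>\<open>T\<close> is \<open>c\<close> on the kernel of \<open>P\<close>; as \<open>c\<close> differs from the mean eigenvalue of \<open>N\<close> on the range
    of \<open>P\<close>, some eigenvalue of \<open>T\<close> is not \<open>c\<close>.\<close>
  define c where "c = mat_trace (N * P) / mat_trace P + 1"
  define T where "T = N * P + c \<cdot>\<^sub>m (1\<^sub>m m - P)"
  have T: "T \<in> carrier_mat m m"
    using N P by (auto simp: T_def)
  have "mat_trace T = mat_trace (N * P) + c * (of_nat m - mat_trace P)"
    unfolding T_def using N P mult_carrier_mat[OF N P] minus_carrier_mat[OF P, of "1\<^sub>m m"]
    by (subst mat_trace_add[of _ m]) (auto simp: mat_trace_smult mat_trace_minus[of _ m] mat_trace_one)
  \<comment> \<open>Equality would mean \<open>mat_trace (N * P) = c * mat_trace P\<close>, whereas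
    the summand 1 in \<open>c\<close> makes the two sides differ by
    \<open>mat_trace P\<close>.\<close>
  also have "\<dots> \<noteq> of_nat m * c"
    using tr by (simp add: c_def field_simps)
  finally obtain k where ev: "eigenvalue T k" and "k \<noteq> c"
    using mat_trace_single_eigenvalue[OF T, of c] by blast
  then obtain v where v: "v \<in> carrier_vec m" "v \<noteq> 0\<^sub>v m" and Tv: "T *\<^sub>v v = k \<cdot>\<^sub>v v"
    using T by (auto simp: eigenvalue_def eigenvector_def)
  have Tv_eq: "T *\<^sub>v v = N *\<^sub>v (P *\<^sub>v v) + c \<cdot>\<^sub>v (v - P *\<^sub>v v)"
  proof -
    have "T *\<^sub>v v = N * P *\<^sub>v v + (c \<cdot>\<^sub>m (1\<^sub>m m - P)) *\<^sub>v v"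
      unfolding T_def using N P v by (subst add_mult_distrib_mat_vec[of _ m m]) auto
    also have "(c \<cdot>\<^sub>m (1\<^sub>m m - P)) *\<^sub>v v = c \<cdot>\<^sub>v ((1\<^sub>m m - P) *\<^sub>v v)"
      using P v by (intro eq_vecI) auto
    also have "(1\<^sub>m m - P) *\<^sub>v v = v - P *\<^sub>v v"
      using P v by (subst minus_mult_distrib_mat_vec[of _ m m]) auto
    finally show ?thesis using N P v by simp
  qed
  have Pv: "P *\<^sub>v v \<in> carrier_vec m" 
    using P v by auto
  have PPv: "P *\<^sub>v (P *\<^sub>v v) = P *\<^sub>v v"
    using idem P v by (metis assoc_mult_mat_vec)
  have PNv: "P *\<^sub>v (N *\<^sub>v (P *\<^sub>v v)) = N *\<^sub>v (P *\<^sub>v v)"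
    using comm P N v Pv PPv by (metis assoc_mult_mat_vec)
  \<comment> \<open>The witness is \<open>P *\<^sub>v v\<close>. If it vanished, \<open>T\<close>
    would act on \<open>v\<close> as the scalar \<open>c\<close>, against
    \<open>k \<noteq> c\<close>.\<close>
  show ?thesis
  proof
    show "P *\<^sub>v v \<noteq> 0\<^sub>v m"
    proof
      assume "P *\<^sub>v v = 0\<^sub>v m"
      with Tv_eq Tv have *: "k \<cdot>\<^sub>v v = c \<cdot>\<^sub>v v"
        using N v by auto
      have "v = 0\<^sub>v m"
      proof (rule eq_vecI)
        fix i assume i: "i < dim_vec (0\<^sub>v m :: complex vec)"
        with * v have "k * v $ i = c * v $ i"
          by (metis index_smult_vec(1) carrier_vecD index_zero_vec(2))
        with i \<open>k \<noteq> c\<close> show "v $ i = 0\<^sub>v m $ i" by simp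
      qed (use v in auto)
      with v show False by simp
    qed
    \<comment> \<open>Applying \<open>P\<close> to the eigenvector equation of \<open>T\<close>
      kills the component in the kernel of \<open>P\<close> and leaves the equation for
      \<open>N\<close>.\<close>
    have "k \<cdot>\<^sub>v (P *\<^sub>v v) = P *\<^sub>v (T *\<^sub>v v)"
      unfolding Tv using P v by (simp add: mult_mat_vec)
    also have "\<dots> = P *\<^sub>v (N *\<^sub>v (P *\<^sub>v v)) + c \<cdot>\<^sub>v (P *\<^sub>v (v - P *\<^sub>v v))"
      unfolding Tv_eq using N P v Pv
      by (simp add: mult_add_distrib_mat_vec[of _ m m] mult_mat_vec[of _ m m])
    also have "P *\<^sub>v (v - P *\<^sub>v v) = 0\<^sub>v m"
      using P v Pv PPv by (simp add: mult_minus_distrib_mat_vec[of _ m m])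
    finally show "N *\<^sub>v (P *\<^sub>v v) = k \<cdot>\<^sub>v (P *\<^sub>v v)"
      using N Pv PNv by auto
  qed (use Pv PPv in auto)
qed

subsection \<open>Real eigenvectors of symmetric unitary matrices\<close>

lemma map_vec_cnj_eq_conjugate: "map_vec cnj v = conjugate v"
  by (intro eq_vecI) auto

lemma map_cnj_involution [simp]:
  "map_vec cnj (map_vec cnj v) = v" "map_mat cnj (map_mat cnj A) = A"
  by (auto intro!: eq_vecI eq_matI)

text \<open>The entrywise conjugate of \<open>N\<close> is its inverse, and eigenvalues of
  \<open>N\<close> have modulus 1. Conjugating \<open>N v = k v\<close> thus shows that the
  conjugate of \<open>v\<close> is an eigenvector for the same \<open>k\<close>; as \<open>P\<close>
  is real, it also stays in the range of \<open>P\<close>. A real combination of the two vectors is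
  then normalised.\<close>

lemma real_eigenvector_in_range:
  fixes N P :: "complex mat"
  assumes N: "N \<in> carrier_mat m m" and sym: "N\<^sup>T = N" and unit: "map_mat cnj N * N = 1\<^sub>m m"
    and P: "P \<in> carrier_mat m m" and real: "map_mat cnj P = P"
    and idem: "P * P = P" and comm: "P * N = N * P" and tr: "mat_trace P \<noteq> 0"
  obtains r k where "r \<in> carrier_vec m" "map_vec cnj r = r" "r \<bullet> r = 1" "P *\<^sub>v r = r"
    "N *\<^sub>v r = k \<cdot>\<^sub>v r" "k * cnj k = 1"
proof -
  obtain v k where v: "v \<in> carrier_vec m" "v \<noteq> 0\<^sub>v m" and Pv: "P *\<^sub>v v = v"
    and Nv: "N *\<^sub>v v = k \<cdot>\<^sub>v v"
    using eigenvector_in_range[OF N P idem comm tr] by blast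
  let ?v = "map_vec cnj v"
  have v': "?v \<in> carrier_vec m"
    using v by simp
  have Pv': "P *\<^sub>v ?v = ?v"
    using cnj.mult_mat_vec_hom[OF P v(1)] real Pv by simp
  have "v = map_mat cnj N *\<^sub>v (N *\<^sub>v v)"
    using unit N v by (metis assoc_mult_mat_vec map_carrier_mat one_mult_mat_vec)
  also have "\<dots> = k \<cdot>\<^sub>v (map_mat cnj N *\<^sub>v v)"
    unfolding Nv using N v by (simp add: mult_mat_vec[of _ m m])
  finally have "?v = cnj k \<cdot>\<^sub>v (N *\<^sub>v ?v)"
    using cnj.mult_mat_vec_hom[of "map_mat cnj N" m m v] N v
    by (metis cnj.vec_hom_smult map_carrier_mat map_cnj_involution(2))
  \<comment> \<open>Unitarity: the Hermitian square of \<open>N *\<^sub>v v\<close> equals that of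
    \<open>v\<close>, and it is also \<open>cnj k * k\<close> times that of
    \<open>v\<close>.\<close>
  moreover have k: "k * cnj k = 1"
  proof -
    have nz: "?v \<bullet> v \<noteq> 0"
      using v conjugate_square_eq_0_vec[of v m] comm_scalar_prod[of ?v m v]
      by (simp add: map_vec_cnj_eq_conjugate)
    have "cnj k * k * (?v \<bullet> v) = map_vec cnj (N *\<^sub>v v) \<bullet> (N *\<^sub>v v)"
      unfolding Nv using v by (simp add: cnj.vec_hom_smult)
    also have "map_vec cnj (N *\<^sub>v v) = (map_mat cnj N)\<^sup>T *\<^sub>v ?v"
      using cnj.mult_mat_vec_hom[OF N v(1)] sym by (simp add: map_mat_transpose)
    also have "\<dots> \<bullet> (N *\<^sub>v v) = ?v \<bullet> (map_mat cnj N *\<^sub>v (N *\<^sub>v v))"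
      using N v by (subst transpose_vec_mult_scalar[of _ m m]) auto
    also have "map_mat cnj N *\<^sub>v (N *\<^sub>v v) = v"
      using unit N v by (metis assoc_mult_mat_vec map_carrier_mat one_mult_mat_vec)
    finally show ?thesis using nz by (simp add: mult.commute)
  qed
  ultimately have "k \<cdot>\<^sub>v ?v = N *\<^sub>v ?v"
    using N v' by (metis mult_mat_vec_carrier one_smult_vec smult_smult_assoc)
  note Nv' = this[symmetric]
  \<comment> \<open>Twice the real part of \<open>v\<close> serves unless it vanishes; in that case
    \<open>v\<close> is purely imaginary and \<open>\<i> \<cdot>\<^sub>v v\<close> is real.\<close>
  obtain u where u: "u \<in> carrier_vec m" "u \<noteq> 0\<^sub>v m" "map_vec cnj u = u"
    and Pu: "P *\<^sub>v u = u" and Nu: "N *\<^sub>v u = k \<cdot>\<^sub>v u"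
  proof (cases "v + ?v = 0\<^sub>v m")
    case False
    show ?thesis
    proof (rule that[of "v + ?v"])
      show "map_vec cnj (v + ?v) = v + ?v"
        using v by (auto intro!: eq_vecI)
      show "P *\<^sub>v (v + ?v) = v + ?v"
        using P v Pv Pv' by (simp add: mult_add_distrib_mat_vec[of _ m m])
      show "N *\<^sub>v (v + ?v) = k \<cdot>\<^sub>v (v + ?v)"
        using N v Nv Nv' by (simp add: mult_add_distrib_mat_vec[of _ m m] smult_add_distrib_vec[of _ m])
    qed (use False v in auto)
  next
    case True
    show ?thesis
    proof (rule that[of "\<i> \<cdot>\<^sub>v v"])
      have "cnj (v $ i) = - v $ i" if "i < m" for i
        using arg_cong[OF True, of "\<lambda>w. w $ i"] that v 
        by (simp add: add_eq_0_iff)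
      then show "map_vec cnj (\<i> \<cdot>\<^sub>v v) = \<i> \<cdot>\<^sub>v v"
        using v by (auto intro!: eq_vecI)
      show "\<i> \<cdot>\<^sub>v v \<noteq> 0\<^sub>v m"
      proof
        assume *: "\<i> \<cdot>\<^sub>v v = 0\<^sub>v m"
        have "v $ i = 0" if "i < m" for i
          using arg_cong[OF *, of "\<lambda>w. w $ i"] that v by simp
        with v show False by (auto intro: eq_vecI)
      qed
      show "P *\<^sub>v (\<i> \<cdot>\<^sub>v v) = \<i> \<cdot>\<^sub>v v"
        using P v Pv by (simp add: mult_mat_vec[of _ m m])
      show "N *\<^sub>v (\<i> \<cdot>\<^sub>v v) = k \<cdot>\<^sub>v (\<i> \<cdot>\<^sub>v v)"
        using N v Nv by (simp add: mult_mat_vec[of _ m m] smult_smult_assoc mult.commute)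
    qed (use v in auto)
  qed
  \<comment> \<open>On a real vector the bilinear product agrees with the Hermitian one, so it is
    positive and can be scaled to 1 by a real factor.\<close>
  have pos: "u \<bullet> u > 0"
    using conjugate_square_greater_0_vec[OF u(1)] u(2,3) unfolding map_vec_cnj_eq_conjugate by metis
  define a where "a = 1 / sqrt (Re (u \<bullet> u))"
  have uu: "u \<bullet> u = complex_of_real (Re (u \<bullet> u))" and "Re (u \<bullet> u) > 0"
    using pos by (auto simp: less_complex_def complex_eq_iff)
  then have "a * a * Re (u \<bullet> u) = 1"
    by (simp add: a_def)
  then have norm: "complex_of_real a * (complex_of_real a * (u \<bullet> u)) = 1"
    by (subst uu) (metis mult.assoc of_real_1 of_real_mult)
  show ?thesis
  proof (rule that)
    show "complex_of_real a \<cdot>\<^sub>v u \<in> carrier_vec m"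
      using u by simp
    show "map_vec cnj (complex_of_real a \<cdot>\<^sub>v u) = complex_of_real a \<cdot>\<^sub>v u"
      using u by (simp add: cnj.vec_hom_smult)
    show "(complex_of_real a \<cdot>\<^sub>v u) \<bullet> (complex_of_real a \<cdot>\<^sub>v u) = 1"
      using u norm by simp
    show "P *\<^sub>v (complex_of_real a \<cdot>\<^sub>v u) = complex_of_real a \<cdot>\<^sub>v u"
      using P u Pu by (simp add: mult_mat_vec[of _ m m])
    show "N *\<^sub>v (complex_of_real a \<cdot>\<^sub>v u) = k \<cdot>\<^sub>v (complex_of_real a \<cdot>\<^sub>v u)"
      using N u Nu by (simp add: mult_mat_vec[of _ m m] smult_smult_assoc mult.commute)
  qed (rule k)
qed

text \<open>The new vector is sought in the range of \<open>P = 1 - Q Q^T\<close>, the orthogonal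
  projection onto the complement of the vectors already found. This projection is real, commutes
  with \<open>N\<close>, and has trace \<open>m - p\<close>.\<close>

lemma extend_real_orthonormal_eigenvectors:
  fixes N :: "complex mat"
  assumes N: "N \<in> carrier_mat m m" and sym: "N\<^sup>T = N" and unit: "map_mat cnj N * N = 1\<^sub>m m"
    and q: "\<And>j. j < p \<Longrightarrow> q j \<in> carrier_vec m" "\<And>j. j < p \<Longrightarrow> map_vec cnj (q j) = q j"
    and ortho: "\<And>i j. i < p \<Longrightarrow> j < p \<Longrightarrow> q i \<bullet> q j = (if i = j then 1 else 0)"
    and ev: "\<And>j. j < p \<Longrightarrow> N *\<^sub>v q j = l j \<cdot>\<^sub>v q j"
    and "p < m"
  obtains r k where "r \<in> carrier_vec m" "map_vec cnj r = r" "r \<bullet> r = 1"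
    "N *\<^sub>v r = k \<cdot>\<^sub>v r" "k * cnj k = 1" "\<And>j. j < p \<Longrightarrow> q j \<bullet> r = 0"
proof -
  define Q where "Q = mat m p (\<lambda>(i, j). q j $ i)"
  define P where "P = 1\<^sub>m m - Q * Q\<^sup>T"
  define L where "L = mat_diag p l"
  have Q: "Q \<in> carrier_mat m p" and QT: "Q\<^sup>T \<in> carrier_mat p m" and L: "L \<in> carrier_mat p p"
    by (auto simp: Q_def L_def)
  have QQT: "Q * Q\<^sup>T \<in> carrier_mat m m"
    using Q by auto
  have P: "P \<in> carrier_mat m m"
    unfolding P_def by (rule minus_carrier_mat[OF QQT])
  have colQ: "col Q j = q j" if "j < p" for j
    using q(1)[OF that] that by (auto simp: Q_def)
  have QTQ: "Q\<^sup>T * Q = 1\<^sub>m p"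
    using Q by (intro eq_matI) (auto simp: colQ ortho)
  have realQ: "map_mat cnj Q = Q"
  proof (rule eq_matI)
    fix i j assume "i < dim_row Q" "j < dim_col Q"
    then have ij: "i < m" "j < p"
      by (auto simp: Q_def)
    then have "map_vec cnj (q j) $ i = cnj (q j $ i)"
      using q(1)[of j] by simp
    then show "map_mat cnj Q $$ (i, j) = Q $$ (i, j)"
      using q(2)[of j] ij by (simp add: Q_def)
  qed (auto simp: Q_def)
  have realP: "map_mat cnj P = P"
  proof -
    have "map_mat cnj (Q * Q\<^sup>T) = Q * Q\<^sup>T"
      using cnj.mat_hom_mult[OF Q QT] realQ by (simp flip: map_mat_transpose)
    moreover have "map_mat cnj P = 1\<^sub>m m - map_mat cnj (Q * Q\<^sup>T)"
      using QQT Q by (intro eq_matI) (auto simp: P_def)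
    ultimately show ?thesis
      by (simp add: P_def)
  qed
  have QT_QQT: "Q\<^sup>T * (Q * Q\<^sup>T) = Q\<^sup>T"
    using assoc_mult_mat[OF QT Q QT] QTQ QT by simp
  have QQT_idem: "(Q * Q\<^sup>T) * (Q * Q\<^sup>T) = Q * Q\<^sup>T"
    using assoc_mult_mat[OF Q QT QQT] QT_QQT by simp
  have idem: "P * P = P"
  proof -
    have "P * P = 1\<^sub>m m * P - (Q * Q\<^sup>T) * P"
      using minus_mult_distrib_mat[OF one_carrier_mat QQT P] by (simp flip: P_def)
    also have "(Q * Q\<^sup>T) * P = Q * Q\<^sup>T - Q * Q\<^sup>T"
      using mult_minus_distrib_mat[OF QQT one_carrier_mat QQT]
      unfolding right_mult_one_mat[OF QQT] QQT_idem P_def .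
    also have "1\<^sub>m m * P - (Q * Q\<^sup>T - Q * Q\<^sup>T) = P"
      using P QQT by (intro eq_matI) auto
    finally show ?thesis .
  qed
  have NQ: "N * Q = Q * L"
  proof (rule eq_matI)
    fix i j assume "i < dim_row (Q * L)" "j < dim_col (Q * L)"
    then have ij: "i < m" "j < p"
      using Q L by auto
    have "(N * Q) $$ (i, j) = (N *\<^sub>v q j) $ i"
      using N Q ij by (simp add: colQ)
    then show "(N * Q) $$ (i, j) = (Q * L) $$ (i, j)"
      using q[of j] Q ij unfolding L_def by (simp add: ev mat_diag_mult_right[OF Q]) (simp add: Q_def)
  qed (use N Q L in auto)
  \<comment> \<open>Commutation comes from symmetry: \<open>N Q Q^T = Q L Q^T\<close> equals its own
    transpose, which is also \<open>Q Q^T N\<close> because \<open>N\<close> is symmetric.\<close>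
  have "N * (Q * Q\<^sup>T) = Q * L * Q\<^sup>T"
    using NQ N Q QT by (metis assoc_mult_mat)
  moreover have "(Q * L * Q\<^sup>T)\<^sup>T = Q * L * Q\<^sup>T"
  proof -
    have "L\<^sup>T = L"
      by (auto simp: L_def mat_diag_def intro!: eq_matI)
    then show ?thesis
      using transpose_mult[OF mult_carrier_mat[OF Q L] QT] transpose_mult[OF Q L] assoc_mult_mat[OF Q L QT]
      by simp
  qed
  moreover have "(N * (Q * Q\<^sup>T))\<^sup>T = Q * Q\<^sup>T * N"
    using transpose_mult[OF N QQT] transpose_mult[OF Q QT] sym by simp
  ultimately have "Q * Q\<^sup>T * N = N * (Q * Q\<^sup>T)"
    by simp
  then have comm: "P * N = N * P"
    unfolding P_def
    using minus_mult_distrib_mat[OF one_carrier_mat QQT N] mult_minus_distrib_mat[OF N one_carrier_mat QQT] N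
    by simp
  \<comment> \<open>By cyclicity, \<open>Q Q^T\<close> has the same trace as \<open>Q^T Q\<close>,
    the identity of size \<open>p\<close>.\<close>
  have "mat_trace P = of_nat m - of_nat p"
    unfolding P_def using mat_trace_minus[OF one_carrier_mat QQT] mat_trace_mult_commute[OF Q QT] QTQ
    by (simp add: mat_trace_one)
  then have tr: "mat_trace P \<noteq> 0"
    using \<open>p < m\<close> by simp
  obtain r k where r: "r \<in> carrier_vec m" "map_vec cnj r = r" "r \<bullet> r = 1" "P *\<^sub>v r = r"
    "N *\<^sub>v r = k \<cdot>\<^sub>v r" "k * cnj k = 1"
    using real_eigenvector_in_range[OF N sym unit P realP idem comm tr] by blast
  \<comment> \<open>Hence every vector fixed by \<open>P\<close> is orthogonal to all columns of
    \<open>Q\<close>.\<close>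
  have "Q\<^sup>T * P = 0\<^sub>m p m"
    unfolding P_def using mult_minus_distrib_mat[OF QT one_carrier_mat QQT] QT QT_QQT by simp
  then have QTr: "Q\<^sup>T *\<^sub>v r = 0\<^sub>m p m *\<^sub>v r"
    using r(4) assoc_mult_mat_vec[OF QT P r(1)] by simp
  have "q j \<bullet> r = 0" if "j < p" for j
  proof -
    have "q j \<bullet> r = (Q\<^sup>T *\<^sub>v r) $ j"
      using that Q colQ by simp
    also have "\<dots> = 0"
      unfolding QTr using that r(1) by simp
    finally show ?thesis .
  qed
  with r that show ?thesis by blast
qed

subsection \<open>Canonical form of antisymmetric unitary matrices\<close>

text \<open>A quarter of the argument taken in \<open>[0, 2 pi)\<close>; this fixes the interval in
  which the angles lie.\<close>

lemma unit_complex_eq_cis_four: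
  assumes "w * cnj w = 1"
  obtains t where "t \<in> {0..<pi / 2}" "cis (4 * t) = w"
proof -
  have "(Re w)\<^sup>2 + (Im w)\<^sup>2 = 1"
    using assms by (simp add: complex_eq_iff power2_eq_square)
  then obtain t where "0 \<le> t" "t < 2 * pi" "Re w = cos t" "Im w = sin t"
    using sincos_total_2pi by blast
  then show ?thesis
    by (intro that[of "t / 4"]) (auto simp: complex_eq_iff)
qed

lemma antisymmetric_scalar_prod:
  fixes M :: "'a :: comm_ring_1 mat"
  assumes M: "M \<in> carrier_mat m m" and anti: "M\<^sup>T = - M"
    and x: "x \<in> carrier_vec m" and y: "y \<in> carrier_vec m"
  shows "(M *\<^sub>v y) \<bullet> x = - (y \<bullet> (M *\<^sub>v x))"
proof -
  have "- (M *\<^sub>v y) = M\<^sup>T *\<^sub>v y"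
    unfolding anti using M y by (intro eq_vecI) auto
  then have "(- (M *\<^sub>v y)) \<bullet> x = y \<bullet> (M *\<^sub>v x)"
    using transpose_vec_mult_scalar[OF M x y] by simp
  then show ?thesis
    using M x y by (metis carrier_vecD mult_mat_vec_carrier scalar_prod_uminus_left minus_minus)
qed

text \<open>The vectors \<open>q (2 l)\<close> and \<open>q (2 l + 1)\<close> are the pair \<open>r, s\<close> with \<open>z = exp (2 i \<theta>\<^sub>l)\<close>.\<close>

definition canonical_pairs ::
  "complex mat \<Rightarrow> nat \<Rightarrow> nat \<Rightarrow> (nat \<Rightarrow> complex vec) \<Rightarrow> (nat \<Rightarrow> real) \<Rightarrow> bool" where
  "canonical_pairs M m k q \<theta> \<longleftrightarrow>
     (\<forall>j<2 * k. q j \<in> carrier_vec m \<and> map_vec cnj (q j) = q j) \<and>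
     (\<forall>i<2 * k. \<forall>j<2 * k. q i \<bullet> q j = (if i = j then 1 else 0)) \<and>
     (\<forall>l<k. \<theta> l \<in> {0..<pi / 2} \<and>
        M *\<^sub>v q (2 * l) = (- cis (2 * \<theta> l)) \<cdot>\<^sub>v q (2 * l + 1) \<and>
        M *\<^sub>v q (2 * l + 1) = cis (2 * \<theta> l) \<cdot>\<^sub>v q (2 * l))"

text \<open>The vectors found so far are eigenvectors of \<open>M * M\<close>, which is symmetric
  and unitary, so a further real eigenvector \<open>r\<close> exists orthogonal to them. Its partner
  \<open>s\<close> is a multiple of \<open>M r\<close>; antisymmetry of \<open>M\<close> supplies
  the orthogonality relations and the norm of \<open>s\<close>.\<close>

lemma canonical_pairs_extend:
  fixes M :: "complex mat"
  assumes M: "M \<in> carrier_mat m m" and anti: "M\<^sup>T = - M" and unit: "map_mat cnj M * M = - 1\<^sub>m m"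
    and pairs: "canonical_pairs M m k q \<theta>" and "2 * k < m"
  obtains q' \<theta>' where "canonical_pairs M m (Suc k) q' \<theta>'"
proof -
  let ?N = "M * M" and ?cM = "map_mat cnj M"
  have N: "?N \<in> carrier_mat m m" and cM: "?cM \<in> carrier_mat m m"
    using M by auto
  have q: "q j \<in> carrier_vec m" "map_vec cnj (q j) = q j" if "j < 2 * k" for j
    using pairs that by (auto simp: canonical_pairs_def)
  have ortho: "q i \<bullet> q j = (if i = j then 1 else 0)" if "i < 2 * k" "j < 2 * k" for i j
    using pairs that by (auto simp: canonical_pairs_def)
  have Meven: "M *\<^sub>v q (2 * l) = (- cis (2 * \<theta> l)) \<cdot>\<^sub>v q (2 * l + 1)"
    and Modd: "M *\<^sub>v q (2 * l + 1) = cis (2 * \<theta> l) \<cdot>\<^sub>v q (2 * l)" if "l < k" for l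
    using pairs that by (auto simp: canonical_pairs_def)
  have sym: "?N\<^sup>T = ?N"
    using M anti by (simp add: transpose_mult[of _ m m])
  have unit_v: "?cM *\<^sub>v (M *\<^sub>v x) = - x" if "x \<in> carrier_vec m" for x
  proof -
    have "?cM *\<^sub>v (M *\<^sub>v x) = (- 1\<^sub>m m) *\<^sub>v x"
      using unit M cM that by (metis assoc_mult_mat_vec)
    also have "\<dots> = - x"
      using that by (intro eq_vecI) auto
    finally show ?thesis .
  qed
  have unitN: "map_mat cnj ?N * ?N = 1\<^sub>m m"
  proof -
    have "map_mat cnj ?N * ?N = ?cM * (?cM * M) * M"
      using M cM by (simp add: cnj.mat_hom_mult[OF M M] assoc_mult_mat[of _ m m _ m _ m])
    also have "\<dots> = 1\<^sub>m m"
      using M cM by (simp add: unit)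
    finally show ?thesis .
  qed
  \<comment> \<open>Applying \<open>M\<close> twice goes once around a pair and multiplies by minus
    the square of \<open>cis (2 * \<theta> l)\<close>. Pair \<open>l\<close> occupies the indices
    \<open>2 * l\<close> and \<open>2 * l + 1\<close>, hence \<open>j div 2\<close>.\<close>
  have evN: "?N *\<^sub>v q j = (- cis (4 * \<theta> (j div 2))) \<cdot>\<^sub>v q j" if "j < 2 * k" for j
  proof (cases "even j")
    case True
    then obtain l where l: "j = 2 * l" by blast
    then have "l < k" using that by simp
    then have "2 * l < 2 * k" "2 * l + 1 < 2 * k" by auto
    then show ?thesis
      using M q Meven[OF \<open>l < k\<close>] Modd[OF \<open>l < k\<close>] unfolding l
      by (simp add: mult_mat_vec[of _ m m] smult_smult_assoc cis_mult)
  next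
    case False
    then obtain l where l: "j = 2 * l + 1" by (blast elim: oddE)
    then have "l < k" using that by simp
    then have "2 * l < 2 * k" "2 * l + 1 < 2 * k" by auto
    then show ?thesis
      using M q Meven[OF \<open>l < k\<close>] Modd[OF \<open>l < k\<close>] unfolding l
      by (simp add: mult_mat_vec[of _ m m] smult_smult_assoc cis_mult)
  qed
  obtain r c where r: "r \<in> carrier_vec m" "map_vec cnj r = r" "r \<bullet> r = 1"
    and Nr: "?N *\<^sub>v r = c \<cdot>\<^sub>v r" and c: "c * cnj c = 1"
    and qr: "\<And>j. j < 2 * k \<Longrightarrow> q j \<bullet> r = 0"
    using extend_real_orthonormal_eigenvectors[OF N sym unitN q ortho evN \<open>2 * k < m\<close>] by blast
  \<comment> \<open>The sign is that of the pairs: \<open>M r = - z s\<close> and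
    \<open>M s = z r\<close> force \<open>c = - z^2\<close>, where
    \<open>z = cis (2 * t)\<close>.\<close>
  obtain t where t: "t \<in> {0..<pi / 2}" and ct: "cis (4 * t) = - c"
    using unit_complex_eq_cis_four[of "- c"] c by auto
  define z where "z = cis (2 * t)"
  have zz: "z * cnj z = 1"
    by (simp add: z_def cis_cnj cis_mult)
  have "z * z = - c"
    using ct by (simp add: z_def cis_mult)
  then have c_eq: "c = - (z * z)"
    by simp
  define s where "s = (- cnj z) \<cdot>\<^sub>v (M *\<^sub>v r)"
  have Mr_carr: "M *\<^sub>v r \<in> carrier_vec m"
    using M r by auto
  then have s: "s \<in> carrier_vec m"
    by (simp add: s_def)
  have MMr: "M *\<^sub>v (M *\<^sub>v r) = c \<cdot>\<^sub>v r"
    using M r Nr by simp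
  have Mr: "M *\<^sub>v r = (- z) \<cdot>\<^sub>v s"
    using zz by (simp add: s_def smult_smult_assoc)
  have "M *\<^sub>v s = (- cnj z * c) \<cdot>\<^sub>v r"
    unfolding s_def using M Mr_carr MMr by (simp add: mult_mat_vec[of _ m m] smult_smult_assoc)
  also have "- cnj z * c = z"
    using zz by (simp add: c_eq algebra_simps)
  finally have Ms: "M *\<^sub>v s = z \<cdot>\<^sub>v r" .
  \<comment> \<open>Since the conjugate of \<open>M\<close> is minus its inverse, applying it to
    \<open>M (M r) = c r\<close> expresses it on \<open>r\<close> through \<open>M r\<close>; with
    \<open>c = - z^2\<close>, the conjugate of \<open>s\<close> becomes \<open>s\<close>
    itself.\<close>
  have real_s: "map_vec cnj s = s"
  proof -
    have "c \<cdot>\<^sub>v (?cM *\<^sub>v r) = ?cM *\<^sub>v (M *\<^sub>v (M *\<^sub>v r))"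
      unfolding MMr using cM r by (simp add: mult_mat_vec[of _ m m])
    also have "\<dots> = - (M *\<^sub>v r)"
      by (rule unit_v[OF Mr_carr])
    finally have *: "c * (?cM *\<^sub>v r) $ i = - (M *\<^sub>v r) $ i" if "i < m" for i
      using that M r
      by (metis (no_types, lifting) carrier_matD(1) carrier_vecD cM dim_mult_mat_vec index_smult_vec(1) index_uminus_vec(1))
    have "map_vec cnj s = (- z) \<cdot>\<^sub>v (?cM *\<^sub>v r)"
      unfolding s_def using cnj.mult_mat_vec_hom[OF M r(1)] r by (simp add: cnj.vec_hom_smult)
    also have "\<dots> = s"
    proof (rule eq_vecI)
      fix i assume "i < dim_vec s"
      then have i: "i < m" using s by simp
      have "(- z) * (?cM *\<^sub>v r) $ i = cnj z * (- (z * z)) * (?cM *\<^sub>v r) $ i"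
        using zz by (simp add: algebra_simps)
      also have "\<dots> = cnj z * (- (M *\<^sub>v r) $ i)"
        using *[OF i] unfolding c_eq mult.assoc by simp
      finally show "((- z) \<cdot>\<^sub>v (?cM *\<^sub>v r)) $ i = s $ i"
        unfolding s_def using i M cM r by simp
    qed (use s cM in auto)
    finally show ?thesis .
  qed
  have ss: "s \<bullet> s = 1"
  proof -
    have "(M *\<^sub>v r) \<bullet> (M *\<^sub>v r) = - c"
      using antisymmetric_scalar_prod[OF M anti Mr_carr r(1)] MMr r by simp
    then have "s \<bullet> s = (- cnj z) * ((- cnj z) * (z * z))"
      unfolding s_def using Mr_carr by (simp add: c_eq)
    then show ?thesis
      using zz by (simp add: algebra_simps)
  qed
  have rs: "r \<bullet> s = 0"
  proof -
    \<comment> \<open>By antisymmetry this product equals its own negative.\<close>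
    have "r \<bullet> (M *\<^sub>v r) = 0"
      using antisymmetric_scalar_prod[OF M anti r(1) r(1)] comm_scalar_prod[OF Mr_carr r(1)]
      by simp
    then show ?thesis
      unfolding s_def using r Mr_carr by simp
  qed
  have qs: "q j \<bullet> s = 0" if j: "j < 2 * k" for j
  proof -
    \<comment> \<open>\<open>M\<close> maps \<open>q j\<close> to a multiple of its partner, an old
      vector and so orthogonal to \<open>r\<close>; antisymmetry then moves \<open>M\<close> over to
      \<open>r\<close>.\<close>
    have "(M *\<^sub>v q j) \<bullet> r = 0"
    proof (cases "even j")
      case True
      then obtain l where l: "j = 2 * l" by blast
      then have "l < k" "2 * l + 1 < 2 * k" using j by auto
      then show ?thesis
        unfolding l using Meven q qr r by simp
    next
      case False
      then obtain l where l: "j = 2 * l + 1" by (blast elim: oddE)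
      then have "l < k" "2 * l < 2 * k" using j by auto
      then show ?thesis
        unfolding l using Modd q qr r by simp
    qed
    then have "q j \<bullet> (M *\<^sub>v r) = 0"
      using antisymmetric_scalar_prod[OF M anti r(1) q(1)[OF j]] by simp
    then show ?thesis
      unfolding s_def using q(1)[OF j] Mr_carr by simp
  qed
  define q' where "q' j = (if j < 2 * k then q j else if j = 2 * k then r else s)" for j
  have "canonical_pairs M m (Suc k) q' (\<theta>(k := t))"
    unfolding canonical_pairs_def
  proof (intro conjI allI impI)
    fix j
    show "q' j \<in> carrier_vec m" "map_vec cnj (q' j) = q' j"
      using q r s real_s by (auto simp: q'_def)
  next
    fix i j assume "i < 2 * Suc k" "j < 2 * Suc k"
    moreover have "r \<bullet> q j = 0" "s \<bullet> q j = 0" if "j < 2 * k" for j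
      using that q(1)[OF that] qr qs r s by (metis comm_scalar_prod)+
    moreover have "s \<bullet> r = 0"
      using rs r s by (metis comm_scalar_prod)
    ultimately show "q' i \<bullet> q' j = (if i = j then 1 else 0)"
      using qr qs rs r ss ortho by (auto simp: q'_def)
  next
    fix l assume "l < Suc k"
    then consider "l < k" | "l = k" by linarith
    then show "(\<theta>(k := t)) l \<in> {0..<pi / 2}"
      "M *\<^sub>v q' (2 * l) = (- cis (2 * (\<theta>(k := t)) l)) \<cdot>\<^sub>v q' (2 * l + 1)"
      "M *\<^sub>v q' (2 * l + 1) = cis (2 * (\<theta>(k := t)) l) \<cdot>\<^sub>v q' (2 * l)"
      using pairs t Mr Ms by (cases; auto simp: q'_def canonical_pairs_def z_def)+
  qed
  then show ?thesis by (rule that)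
qed

lemma canonical_pairs_exist:
  fixes M :: "complex mat"
  assumes "M \<in> carrier_mat m m" "M\<^sup>T = - M" "map_mat cnj M * M = - 1\<^sub>m m" "2 * k \<le> m"
  shows "\<exists>q \<theta>. canonical_pairs M m k q \<theta>"
  using \<open>2 * k \<le> m\<close>
proof (induction k)
  case 0
  show ?case by (simp add: canonical_pairs_def)
next
  case (Suc k)
  then obtain q \<theta> where "canonical_pairs M m k q \<theta>" by auto
  moreover have "2 * k < m"
    using Suc.prems by simp
  ultimately show ?case
    using canonical_pairs_extend[OF assms(1-3)] by blast
qed

subsection \<open>Complexified quaternionic unitary matrices\<close>

lemma mat_adjoint_eq_transpose: "mat_adjoint A = (map_mat cnj A)\<^sup>T"
  by (intro eq_matI) (auto simp: mat_adjoint_def mat_of_rows_def)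

section \<open>The matrix \<open>J\<close> of the standard symplectic form\<close>

definition sympl :: "nat \<Rightarrow> complex mat" where
  "sympl n = four_block_mat (0\<^sub>m n n) (1\<^sub>m n) (- 1\<^sub>m n) (0\<^sub>m n n)"

lemma sympl_carrier [simp]: "sympl n \<in> carrier_mat (2 * n) (2 * n)"
  by (auto simp: sympl_def)

lemma sympl_dim [simp]: "dim_row (sympl n) = 2 * n" "dim_col (sympl n) = 2 * n"
  by (simp_all add: sympl_def)

lemma sympl_transpose: "(sympl n)\<^sup>T = - sympl n"
  by (intro eq_matI) (auto simp: sympl_def)

lemma map_cnj_sympl: "map_mat cnj (sympl n) = sympl n"
  by (intro eq_matI) (auto simp: sympl_def)

lemma four_block_mult_sympl:
  assumes "A \<in> carrier_mat n n" "B \<in> carrier_mat n n" "C \<in> carrier_mat n n" "D \<in> carrier_mat n n"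
  shows "four_block_mat A B C D * sympl n = four_block_mat (- B) A (- D) C"
    "sympl n * four_block_mat A B C D = four_block_mat C D (- A) (- B)"
  unfolding sympl_def using assms
  by (simp_all add: mult_four_block_mat[of _ n n _ n _ n _ _ n _ n])

lemma sympl_square: "sympl n * sympl n = - 1\<^sub>m (2 * n)"
proof -
  have "sympl n * sympl n = four_block_mat (- 1\<^sub>m n) (0\<^sub>m n n) (- 0\<^sub>m n n) (- 1\<^sub>m n)"
    using four_block_mult_sympl(1)[of "0\<^sub>m n n" n "1\<^sub>m n" "- 1\<^sub>m n" "0\<^sub>m n n"]
    by (simp add: sympl_def)
  also have "\<dots> = - 1\<^sub>m (2 * n)"
    by (intro eq_matI) auto
  finally show ?thesis .
qed

lemma four_block_mat_inject:
  assumes "four_block_mat A B C D = four_block_mat A' B' C' D'"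
    and "A \<in> carrier_mat n n" "B \<in> carrier_mat n n" "C \<in> carrier_mat n n" "D \<in> carrier_mat n n"
    and "A' \<in> carrier_mat n n" "B' \<in> carrier_mat n n" "C' \<in> carrier_mat n n" "D' \<in> carrier_mat n n"
  shows "A = A'" "B = B'" "C = C'" "D = D'"
proof -
  have eq: "four_block_mat A B C D $$ (i, j) = four_block_mat A' B' C' D' $$ (i, j)" for i j
    using assms(1) by simp
  show "A = A'"
  proof (rule eq_matI)
    fix i j assume "i < dim_row A'" "j < dim_col A'"
    then show "A $$ (i, j) = A' $$ (i, j)"
      using eq[of i j] assms(2-) by auto
  qed (use assms(2-) in auto)
  show "B = B'"
  proof (rule eq_matI)
    fix i j assume "i < dim_row B'" "j < dim_col B'"
    then show "B $$ (i, j) = B' $$ (i, j)"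
      using eq[of i "n + j"] assms(2-) by auto
  qed (use assms(2-) in auto)
  show "C = C'"
  proof (rule eq_matI)
    fix i j assume "i < dim_row C'" "j < dim_col C'"
    then show "C $$ (i, j) = C' $$ (i, j)"
      using eq[of "n + i" j] assms(2-) by auto
  qed (use assms(2-) in auto)
  show "D = D'"
  proof (rule eq_matI)
    fix i j assume "i < dim_row D'" "j < dim_col D'"
    then show "D $$ (i, j) = D' $$ (i, j)"
      using eq[of "n + i" "n + j"] assms(2-) by auto
  qed (use assms(2-) in auto)
qed

section \<open>Complexification as an injective homomorphism compatible with adjoints\<close>

lemma complexify_carrier [simp]:
  "W \<in> carrier_mat n n \<Longrightarrow> complexify W \<in> carrier_mat (2 * n) (2 * n)"
  by (auto simp: complexify_def)

lemma quat_component_sum: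
  "quat_re (sum f A) = (\<Sum>x\<in>A. quat_re (f x))" "quat_i (sum f A) = (\<Sum>x\<in>A. quat_i (f x))"
  "quat_j (sum f A) = (\<Sum>x\<in>A. quat_j (f x))" "quat_k (sum f A) = (\<Sum>x\<in>A. quat_k (f x))"
  by (induction A rule: infinite_finite_induct; simp add: zero_quat_def plus_quat_def)+

lemma complex_blocks_sum:
  "Complex (quat_re (sum f A)) (quat_i (sum f A)) = (\<Sum>x\<in>A. Complex (quat_re (f x)) (quat_i (f x)))"
  "Complex (quat_j (sum f A)) (quat_k (sum f A)) = (\<Sum>x\<in>A. Complex (quat_j (f x)) (quat_k (f x)))"
  "Complex (- quat_j (sum f A)) (quat_k (sum f A)) = (\<Sum>x\<in>A. Complex (- quat_j (f x)) (quat_k (f x)))"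
  "Complex (quat_re (sum f A)) (- quat_i (sum f A)) = (\<Sum>x\<in>A. Complex (quat_re (f x)) (- quat_i (f x)))"
  by (simp_all add: complex_eq_iff quat_component_sum sum_negf)

text \<open>Multiplicativity of the representation of a quaternion \<open>a + b j\<close>, with
  \<open>a\<close> and \<open>b\<close> complex, by the matrix with rows \<open>(a, b)\<close> and
  \<open>(- cnj b, cnj a)\<close>.\<close>

lemma complex_blocks_mult:
  "Complex (quat_re (p * q)) (quat_i (p * q)) =
     Complex (quat_re p) (quat_i p) * Complex (quat_re q) (quat_i q)
     + Complex (quat_j p) (quat_k p) * Complex (- quat_j q) (quat_k q)"
  "Complex (quat_j (p * q)) (quat_k (p * q)) =
     Complex (quat_re p) (quat_i p) * Complex (quat_j q) (quat_k q)
     + Complex (quat_j p) (quat_k p) * Complex (quat_re q) (- quat_i q)"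
  "Complex (- quat_j (p * q)) (quat_k (p * q)) =
     Complex (- quat_j p) (quat_k p) * Complex (quat_re q) (quat_i q)
     + Complex (quat_re p) (- quat_i p) * Complex (- quat_j q) (quat_k q)"
  "Complex (quat_re (p * q)) (- quat_i (p * q)) =
     Complex (- quat_j p) (quat_k p) * Complex (quat_j q) (quat_k q)
     + Complex (quat_re p) (- quat_i p) * Complex (quat_re q) (- quat_i q)"
  by (simp_all add: complex_eq_iff times_quat_def)

lemma complexify_mult:
  assumes A: "A \<in> carrier_mat n n" and B: "B \<in> carrier_mat n n"
  shows "complexify (A * B) = complexify A * complexify B"
proof -
  let ?f = "\<lambda>f Y. map_mat f Y :: complex mat"
  let ?f1 = "?f (\<lambda>q. Complex (quat_re q) (quat_i q))" and ?f2 = "?f (\<lambda>q. Complex (quat_j q) (quat_k q))"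
  let ?f3 = "?f (\<lambda>q. Complex (- quat_j q) (quat_k q))" and ?f4 = "?f (\<lambda>q. Complex (quat_re q) (- quat_i q))"
  have "complexify A * complexify B = four_block_mat
      (?f1 A * ?f1 B + ?f2 A * ?f3 B) (?f1 A * ?f2 B + ?f2 A * ?f4 B)
      (?f3 A * ?f1 B + ?f4 A * ?f3 B) (?f3 A * ?f2 B + ?f4 A * ?f4 B)"
    unfolding complexify_def using A B by (intro mult_four_block_mat) auto
  also have "\<dots> = complexify (A * B)"
    unfolding complexify_def using A B
    by (intro cong_four_block_mat eq_matI)
      (auto simp: scalar_prod_def complex_blocks_sum complex_blocks_mult sum.distrib)
  finally show ?thesis ..
qed

lemma complexify_one: "complexify (1\<^sub>m n) = 1\<^sub>m (2 * n)"
  by (intro eq_matI) (auto simp: complexify_def complex_eq_iff one_quat_def zero_quat_def)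

lemma complexify_adjoint: "complexify (quat_adjoint W) = mat_adjoint (complexify W)"
  unfolding mat_adjoint_eq_transpose
  by (intro eq_matI) (auto simp: complexify_def quat_adjoint_def quat_cnj_def complex_eq_iff)

lemma quat_adjoint_carrier [simp]: "W \<in> carrier_mat n n \<Longrightarrow> quat_adjoint W \<in> carrier_mat n n"
  by (auto simp: quat_adjoint_def)

text \<open>The two upper blocks already contain all four quaternion components.\<close>

lemma complexify_inject:
  assumes eq: "complexify A = complexify B" and A: "A \<in> carrier_mat n n" and B: "B \<in> carrier_mat n n"
  shows "A = B"
proof (rule eq_matI)
  note blocks = four_block_mat_inject(1,2)[OF eq[unfolded complexify_def], of n]
  fix i j assume "i < dim_row B" "j < dim_col B"
  then show "A $$ (i, j) = B $$ (i, j)"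
    using blocks[THEN arg_cong, of "\<lambda>X. X $$ (i, j)"] A B by (auto simp: quat_eq_iff)
qed (use A B in auto)

text \<open>A complexified matrix has blocks \<open>A\<close>, \<open>B\<close> above
  \<open>- cnj B\<close>, \<open>cnj A\<close>; commuting with \<open>J\<close> up to conjugation
  expresses exactly this pattern.\<close>

lemma complexify_sympl:
  assumes "W \<in> carrier_mat n n"
  shows "complexify W * sympl n = sympl n * map_mat cnj (complexify W)"
proof -
  have "map_mat cnj (complexify W) = four_block_mat
     (map_mat (\<lambda>q. Complex (quat_re q) (- quat_i q)) W)
     (map_mat (\<lambda>q. Complex (quat_j q) (- quat_k q)) W)
     (map_mat (\<lambda>q. Complex (- quat_j q) (- quat_k q)) W)
     (map_mat (\<lambda>q. Complex (quat_re q) (quat_i q)) W)"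
    using assms by (intro eq_matI) (auto simp: complexify_def complex_eq_iff)
  then show ?thesis
    unfolding complexify_def using assms
    by (simp add: four_block_mult_sympl) (intro cong_four_block_mat eq_matI; auto simp: complex_eq_iff)
qed

text \<open>Comparing blocks shows that the lower two are \<open>- cnj B\<close> and
  \<open>cnj A\<close>, so the quaternion entries can be read off the upper two.\<close>

lemma sympl_commute_imp_complexify:
  assumes X: "X \<in> carrier_mat (2 * n) (2 * n)" and eq: "X * sympl n = sympl n * map_mat cnj X"
  obtains W where "W \<in> carrier_mat n n" "X = complexify W"
proof -
  obtain A B C D where split: "split_block X n n = (A, B, C, D)"
    by (cases "split_block X n n") auto
  from split_block[OF this, of n n] X
  have carr: "A \<in> carrier_mat n n" "B \<in> carrier_mat n n" "C \<in> carrier_mat n n" "D \<in> carrier_mat n n"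
    and X_eq: "X = four_block_mat A B C D"
    by (auto simp: mult_2)
  have cX: "map_mat cnj X = four_block_mat (map_mat cnj A) (map_mat cnj B) (map_mat cnj C) (map_mat cnj D)"
    unfolding X_eq using carr by (intro map_four_block_mat)
  have "four_block_mat (- B) A (- D) C
      = four_block_mat (map_mat cnj C) (map_mat cnj D) (- map_mat cnj A) (- map_mat cnj B)"
    using eq carr unfolding cX unfolding X_eq by (simp add: four_block_mult_sympl)
  from four_block_mat_inject(1,2)[OF this, of n] carr
  have BC: "- B = map_mat cnj C" and AD: "A = map_mat cnj D"
    by auto
  define W where "W = mat n n (\<lambda>(i, j). 
    Quat (Re (A $$ (i, j))) (Im (A $$ (i, j))) (Re (B $$ (i, j))) (Im (B $$ (i, j))))"
  have C: "C $$ (i, j) = - cnj (B $$ (i, j))" if "i < n" "j < n" for i j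
    using arg_cong[OF BC, of "\<lambda>X. X $$ (i, j)"] that carr by (auto simp: complex_eq_iff)
  have D: "D $$ (i, j) = cnj (A $$ (i, j))" if "i < n" "j < n" for i j
    using arg_cong[OF AD, of "\<lambda>X. X $$ (i, j)"] that carr by (auto simp: complex_eq_iff)
  have "X = complexify W"
    unfolding X_eq complexify_def using carr
    by (intro cong_four_block_mat eq_matI) (auto simp: W_def C D complex_eq_iff)
  then show ?thesis
    by (intro that[of W]) (auto simp: W_def)
qed

text \<open>A one-sided inverse of a square matrix is two-sided; the remaining identities follow by
  transposition.\<close>

lemma unitary_mat_identities:
  assumes X: "X \<in> carrier_mat m m" and unit: "mat_adjoint X * X = 1\<^sub>m m"
  shows "(map_mat cnj X)\<^sup>T * X = 1\<^sub>m m" "X * (map_mat cnj X)\<^sup>T = 1\<^sub>m m"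
    "X\<^sup>T * map_mat cnj X = 1\<^sub>m m" "map_mat cnj X * X\<^sup>T = 1\<^sub>m m"
proof -
  have cX: "map_mat cnj X \<in> carrier_mat m m" and cXT: "(map_mat cnj X)\<^sup>T \<in> carrier_mat m m"
    and XT: "X\<^sup>T \<in> carrier_mat m m"
    using X by auto
  show *: "(map_mat cnj X)\<^sup>T * X = 1\<^sub>m m"
    using unit by (simp add: mat_adjoint_eq_transpose)
  show **: "X * (map_mat cnj X)\<^sup>T = 1\<^sub>m m"
    by (rule mat_mult_left_right_inverse[OF cXT X *])
  show "X\<^sup>T * map_mat cnj X = 1\<^sub>m m" 
    using transpose_mult[OF cXT X] * by simp
  show "map_mat cnj X * X\<^sup>T = 1\<^sub>m m"
    using transpose_mult[OF X cXT] ** by simp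
qed

text \<open>For unitary \<open>X\<close> the transpose is inverse to the conjugate, so
  \<open>X J X^T = J\<close> amounts to \<open>X J = J (cnj X)\<close>, which characterises
  complexified matrices. The decomposition can thus be treated without quaternions.\<close>

lemma complexified_quat_unitary_iff:
  "X \<in> complexified_quat_unitary_mats n \<longleftrightarrow>
     X \<in> complex_unitary_mats (2 * n) \<and> X * sympl n * X\<^sup>T = sympl n"
proof
  assume "X \<in> complexified_quat_unitary_mats n"
  then obtain W where W: "W \<in> carrier_mat n n" "quat_adjoint W * W = 1\<^sub>m n" and X: "X = complexify W"
    by (auto simp: complexified_quat_unitary_mats_def)
  have carr: "X \<in> carrier_mat (2 * n) (2 * n)"
    using W X by simp
  have unit: "mat_adjoint X * X = 1\<^sub>m (2 * n)"
    using complexify_mult[OF quat_adjoint_carrier[OF W(1)] W(1)] W by (simp add: X complexify_one flip: complexify_adjoint)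
  have "X * sympl n * X\<^sup>T = sympl n * (map_mat cnj X * X\<^sup>T)"
    unfolding X complexify_sympl[OF W(1)] using W
    by (intro assoc_mult_mat[of _ "2 * n" "2 * n" _ "2 * n" _ "2 * n"]) auto
  then show "X \<in> complex_unitary_mats (2 * n) \<and> X * sympl n * X\<^sup>T = sympl n"
    using unitary_mat_identities[OF carr unit] carr unit right_mult_one_mat[OF sympl_carrier]
    by (simp add: complex_unitary_mats_def)
next
  assume "X \<in> complex_unitary_mats (2 * n) \<and> X * sympl n * X\<^sup>T = sympl n"
  then have carr: "X \<in> carrier_mat (2 * n) (2 * n)" and unit: "mat_adjoint X * X = 1\<^sub>m (2 * n)"
    and eq: "X * sympl n * X\<^sup>T = sympl n"
    by (auto simp: complex_unitary_mats_def)
  \<comment> \<open>Multiplying the invariance of \<open>J\<close> on the right by the conjugate of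
    \<open>X\<close> cancels the transpose.\<close>
  have "X * sympl n * X\<^sup>T * map_mat cnj X = X * sympl n * (X\<^sup>T * map_mat cnj X)"
    using carr by (intro assoc_mult_mat[OF mult_carrier_mat[OF carr sympl_carrier], of _ "2 * n" _ "2 * n"]) auto
  then have "sympl n * map_mat cnj X = X * sympl n * (X\<^sup>T * map_mat cnj X)"
    by (simp add: eq)
  then have "X * sympl n = sympl n * map_mat cnj X"
    using unitary_mat_identities[OF carr unit] right_mult_one_mat[OF mult_carrier_mat[OF carr sympl_carrier]]
    by simp
  then obtain W where W: "W \<in> carrier_mat n n" and X: "X = complexify W"
    using sympl_commute_imp_complexify carr by blast
  have "complexify (quat_adjoint W * W) = complexify (1\<^sub>m n)"
    using unit unfolding X
    by (simp add: complexify_mult[OF quat_adjoint_carrier[OF W] W] complexify_one complexify_adjoint)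
  then have "quat_adjoint W * W = 1\<^sub>m n"
    using mult_carrier_mat[OF quat_adjoint_carrier[OF W] W] by (intro complexify_inject[of _ _ n]) auto
  with W X show "X \<in> complexified_quat_unitary_mats n"
    by (auto simp: complexified_quat_unitary_mats_def)
qed

subsection \<open>Existence and uniqueness of the decomposition\<close>

definition phase_block :: "nat \<Rightarrow> (nat \<Rightarrow> real) \<Rightarrow> complex mat" where
  "phase_block n \<theta> = four_block_mat (phase_diag n \<theta>) (0\<^sub>m n n) (0\<^sub>m n n) (phase_diag n \<theta>)"

text \<open>The product \<open>(D \<oplus> D) J (D \<oplus> D)\<close>, which is the canonical form
  of \<open>U J U^T\<close> under real orthogonal congruence.\<close>

definition phase_sympl :: "nat \<Rightarrow> (nat \<Rightarrow> real) \<Rightarrow> complex mat" where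
  "phase_sympl n \<theta> = four_block_mat (0\<^sub>m n n) (mat_diag n (\<lambda>l. cis (2 * \<theta> l)))
     (mat_diag n (\<lambda>l. - cis (2 * \<theta> l))) (0\<^sub>m n n)"

lemma phase_diag_cis: "phase_diag n \<theta> = mat_diag n (\<lambda>l. cis (\<theta> l))"
  by (simp add: phase_diag_def cis_conv_exp)

lemmas block_simps = mult_four_block_mat[of _ n n _ n _ n _ _ n _ n] left_mult_zero_mat[of _ n n n]
  right_mult_zero_mat[of _ n n n] left_add_zero_mat[of _ n n] right_add_zero_mat[of _ n n] for n

lemma phase_block_carrier [simp]: "phase_block n \<theta> \<in> carrier_mat (2 * n) (2 * n)"
  by (auto simp: phase_block_def phase_diag_def mat_diag_def)

lemma phase_sympl_carrier [simp]: "phase_sympl n \<theta> \<in> carrier_mat (2 * n) (2 * n)"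
  by (auto simp: phase_sympl_def mat_diag_def)

lemma phase_sympl_dim [simp]: "dim_row (phase_sympl n \<theta>) = 2 * n" "dim_col (phase_sympl n \<theta>) = 2 * n"
  by (simp_all add: phase_sympl_def mat_diag_def)

lemma phase_block_transpose: "(phase_block n \<theta>)\<^sup>T = phase_block n \<theta>"
  by (intro eq_matI) (auto simp: phase_block_def phase_diag_def mat_diag_def)

lemma phase_block_inverse: "phase_block n \<theta> * map_mat cnj (phase_block n \<theta>) = 1\<^sub>m (2 * n)"
proof -
  have "map_mat cnj (phase_block n \<theta>) = four_block_mat (mat_diag n (\<lambda>l. cis (- \<theta> l))) (0\<^sub>m n n) (0\<^sub>m n n)
      (mat_diag n (\<lambda>l. cis (- \<theta> l)))"
    by (intro eq_matI) (auto simp: phase_block_def phase_diag_cis mat_diag_def cis_cnj)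
  then show ?thesis
    by (simp add: phase_block_def phase_diag_cis block_simps[where n = n] cis_mult
        mult_2)
qed

lemma phase_block_sympl: "phase_block n \<theta> * sympl n * phase_block n \<theta> = phase_sympl n \<theta>"
proof -
  have "phase_block n \<theta> * sympl n = four_block_mat (- 0\<^sub>m n n) (phase_diag n \<theta>) (- phase_diag n \<theta>) (0\<^sub>m n n)"
    unfolding phase_block_def by (intro four_block_mult_sympl) (auto simp: phase_diag_def)
  also have "\<dots> = four_block_mat (0\<^sub>m n n) (phase_diag n \<theta>) (mat_diag n (\<lambda>l. - cis (\<theta> l))) (0\<^sub>m n n)"
    by (intro cong_four_block_mat eq_matI) (auto simp: phase_diag_cis mat_diag_def)
  finally show ?thesis
    by (simp add: phase_block_def phase_sympl_def phase_diag_cis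
        block_simps[where n = n] cis_mult)
qed

lemma phase_sympl_square:
  "phase_sympl n \<theta> * phase_sympl n \<theta> = four_block_mat (mat_diag n (\<lambda>l. - cis (4 * \<theta> l))) (0\<^sub>m n n)
     (0\<^sub>m n n) (mat_diag n (\<lambda>l. - cis (4 * \<theta> l)))"
  by (simp add: phase_sympl_def block_simps[where n = n] cis_mult)

section \<open>Uniqueness of the phases\<close>

lemma decomposition_sympl:
  assumes dec: "is_decomposition n U R \<theta> Q" and RC_def: "RC = map_mat complex_of_real R"
  shows "U * sympl n * U\<^sup>T = RC * phase_sympl n \<theta> * RC\<^sup>T"
    "RC \<in> carrier_mat (2 * n) (2 * n)" "RC\<^sup>T * RC = 1\<^sub>m (2 * n)"
proof -
  let ?P = "phase_block n \<theta>" and ?J = "sympl n"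
  have R: "R \<in> carrier_mat (2 * n) (2 * n)" "R\<^sup>T * R = 1\<^sub>m (2 * n)"
    and Q: "Q \<in> complex_unitary_mats (2 * n)" "Q * ?J * Q\<^sup>T = ?J"
    and U: "U = RC * ?P * Q"
    using dec unfolding is_decomposition_def complexified_quat_unitary_iff RC_def phase_block_def
    by (auto simp: real_orthogonal_mats_def)
  show RC: "RC \<in> carrier_mat (2 * n) (2 * n)"
    using R by (simp add: RC_def)
  show "RC\<^sup>T * RC = 1\<^sub>m (2 * n)"
    using of_real_hom.mat_hom_mult[of "R\<^sup>T" "2 * n" "2 * n" R "2 * n", where ?'a = complex] R
    by (simp add: RC_def of_real_hom.mat_hom_one flip: map_mat_transpose)
  have Qc: "Q \<in> carrier_mat (2 * n) (2 * n)" and P: "?P \<in> carrier_mat (2 * n) (2 * n)"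
    using Q by (auto simp: complex_unitary_mats_def)
  note assoc = assoc_mult_mat[of _ "2 * n" "2 * n" _ "2 * n" _ "2 * n"]
  have "U\<^sup>T = Q\<^sup>T * (?P * RC\<^sup>T)"
    unfolding U using RC P Qc
    by (simp add: transpose_mult[of _ "2 * n" "2 * n" _ "2 * n"] mult_carrier_mat[of _ "2 * n" "2 * n" _ "2 * n"]
        phase_block_transpose)
  \<comment> \<open>\<open>Q\<close> occurs only in \<open>Q J Q^T\<close>, which is
    \<open>J\<close>, and so drops out.\<close>
  then have "U * ?J * U\<^sup>T = RC * (?P * (Q * ?J * Q\<^sup>T) * ?P) * RC\<^sup>T"
    unfolding U using RC P Qc by (simp add: assoc mult_carrier_mat[of _ "2 * n" "2 * n" _ "2 * n"])
  then show "U * ?J * U\<^sup>T = RC * phase_sympl n \<theta> * RC\<^sup>T"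
    by (simp add: Q phase_block_sympl)
qed

text \<open>The left side depends on \<open>U\<close> alone and the right side on the angles alone.
  By orthogonality of \<open>R\<close> the squared matrix is similar to the square of the canonical
  form, a diagonal matrix with two equal blocks, whence the factor 2.\<close>

lemma decomposition_char_poly:
  assumes dec: "is_decomposition n U R \<theta> Q"
  shows "proots (char_poly ((U * sympl n * U\<^sup>T) * (U * sympl n * U\<^sup>T)))
    = repeat_mset 2 (image_mset (\<lambda>l. - cis (4 * \<theta> l)) (mset_set {..<n}))"
proof -
  define RC where "RC = map_mat complex_of_real R"
  note RC = decomposition_sympl[OF dec RC_def]
  let ?M = "U * sympl n * U\<^sup>T" and ?S = "phase_sympl n \<theta>"
  have RC': "RC * RC\<^sup>T = 1\<^sub>m (2 * n)"
    using RC by (intro mat_mult_left_right_inverse[OF _ _ RC(3)]) auto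
  note assoc = assoc_mult_mat[of _ "2 * n" "2 * n" _ "2 * n" _ "2 * n"]
  have S2: "?S * ?S \<in> carrier_mat (2 * n) (2 * n)"
    by (rule mult_carrier_mat[OF phase_sympl_carrier phase_sympl_carrier])
  have "?M * ?M = RC * (?S * (RC\<^sup>T * RC) * ?S) * RC\<^sup>T"
    unfolding RC(1) using RC(2) by (simp add: assoc mult_carrier_mat[of _ "2 * n" "2 * n" _ "2 * n"])
  then have "?M * ?M = RC * (?S * ?S) * RC\<^sup>T"
    by (simp add: RC(3))
  then have "similar_mat (?M * ?M) (?S * ?S)"
    using RC RC' S2 by (intro similar_matI[of _ _ RC "RC\<^sup>T" "2 * n"]) auto
  then have "char_poly (?M * ?M) = char_poly (?S * ?S)"
    by (rule char_poly_similar)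
  also have "\<dots> = (\<Prod>a\<leftarrow>diag_mat (?S * ?S). [:- a, 1:])"
    by (rule char_poly_upper_triangular[OF S2]) (auto simp: phase_sympl_square mat_diag_def upper_triangular_def)
  also have "diag_mat (?S * ?S) = map (\<lambda>l. - cis (4 * \<theta> l)) [0..<n] @ map (\<lambda>l. - cis (4 * \<theta> l)) [0..<n]"
    unfolding phase_sympl_square
    by (subst diag_four_block_mat[of _ n _ n]) (auto simp: diag_mat_def mat_diag_def)
  finally have "char_poly (?M * ?M) = (\<Prod>l<n. [:cis (4 * \<theta> l), 1:]) ^ 2"
    using prod.distinct_set_conv_list[of "[0..<n]" "\<lambda>l. [:cis (4 * \<theta> l), 1:]"]
    by (simp add: power2_eq_square comp_def atLeast0LessThan)
  also have "proots \<dots> = repeat_mset 2 (\<Sum>l<n. {#- cis (4 * \<theta> l)#})"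
    by (subst proots_power, subst proots_prod) auto
  finally show ?thesis
    by (simp add: sum_unfold_sum_mset)
qed

text \<open>Both arguments lie in \<open>[0, 2 pi)\<close>, so they cannot differ by a nonzero
  multiple of \<open>2 pi\<close>.\<close>

lemma cis_four_inject:
  assumes "s \<in> {0..<pi / 2}" "t \<in> {0..<pi / 2}" "cis (4 * s) = cis (4 * t)"
  shows "s = t"
proof -
  obtain k :: int where k: "4 * s = 4 * t + 2 * pi * of_int k"
    using assms(3) sin_cos_eq_iff[of "4 * s" "4 * t"] by (auto simp: complex_eq_iff)
  moreover have "0 \<le> s" "s < pi / 2" "0 \<le> t" "t < pi / 2"
    using assms(1,2) by auto
  ultimately have "2 * pi * real_of_int k < 2 * pi * 1" "2 * pi * (- 1) < 2 * pi * real_of_int k"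
    by linarith+
  then have "real_of_int k < 1" "- 1 < real_of_int k"
    unfolding mult_less_cancel_left_pos[OF mult_pos_pos[OF zero_less_numeral pi_gt_zero]] by auto
  then have "k = 0" by linarith
  with k show ?thesis by simp
qed

text \<open>Both angle families describe the roots of one polynomial. After cancelling the doubled
  multiplicity, equality of the two multisets yields the permutation, and injectivity of
  \<open>cis (4 * t)\<close> on the angle interval recovers the angles themselves.\<close>

lemma decomposition_unique:
  assumes dec: "is_decomposition n U R \<theta> Q" "is_decomposition n U R' \<theta>' Q'"
  obtains \<sigma> where "\<sigma> permutes {..<n}"
    "\<And>l. l < n \<Longrightarrow> phase_diag n \<theta>' $$ (l, l) = phase_diag n \<theta> $$ (\<sigma> l, \<sigma> l)"
proof -
  have "repeat_mset 2 (image_mset (\<lambda>l. - cis (4 * \<theta>' l)) (mset_set {..<n}))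
      = repeat_mset 2 (image_mset (\<lambda>l. - cis (4 * \<theta> l)) (mset_set {..<n}))"
    using dec[THEN decomposition_char_poly] by simp
  then have "image_mset (\<lambda>l. - cis (4 * \<theta>' l)) (mset_set {..<n})
      = image_mset (\<lambda>l. - cis (4 * \<theta> l)) (mset_set {..<n})"
    by (simp add: repeat_mset_cancel1)
  then obtain \<sigma> where \<sigma>: "\<sigma> permutes {..<n}"
    and eq: "\<forall>l\<in>{..<n}. - cis (4 * \<theta>' l) = - cis (4 * \<theta> (\<sigma> l))"
    using image_mset_eq_implies_permutes[of "{..<n}"] by (metis finite_lessThan)
  show ?thesis
  proof (rule that[OF \<sigma>])
    fix l assume l: "l < n"
    then have \<sigma>l: "\<sigma> l < n"
      using permutes_in_image[OF \<sigma>, of l] by simp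
    have "\<theta>' l = \<theta> (\<sigma> l)"
      using dec l \<sigma>l eq by (intro cis_four_inject) (auto simp: is_decomposition_def)
    then show "phase_diag n \<theta>' $$ (l, l) = phase_diag n \<theta> $$ (\<sigma> l, \<sigma> l)"
      using l \<sigma>l by (simp add: phase_diag_def mat_diag_def)
  qed
qed

section \<open>Existence of the decomposition\<close>

lemma antisymmetric_unitary_canonical_form:
  fixes M :: "complex mat"
  assumes M: "M \<in> carrier_mat (2 * n) (2 * n)" "M\<^sup>T = - M" "map_mat cnj M * M = - 1\<^sub>m (2 * n)"
  obtains R \<theta> where "R \<in> real_orthogonal_mats (2 * n)" "\<And>l. l < n \<Longrightarrow> \<theta> l \<in> {0..<pi / 2}"
    "(map_mat complex_of_real R)\<^sup>T * M * map_mat complex_of_real R = phase_sympl n \<theta>"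
proof -
  obtain q \<theta> where "canonical_pairs M (2 * n) n q \<theta>"
    using canonical_pairs_exist[OF M, of n] by auto
  note pairs = this[unfolded canonical_pairs_def]
  have q: "q j \<in> carrier_vec (2 * n)" "map_vec cnj (q j) = q j" if "j < 2 * n" for j
    using pairs that by auto
  have ortho: "q i \<bullet> q j = (if i = j then 1 else 0)" if "i < 2 * n" "j < 2 * n" for i j
    using pairs that by auto
  have \<theta>: "\<theta> l \<in> {0..<pi / 2}"
    and Meven: "M *\<^sub>v q (2 * l) = (- cis (2 * \<theta> l)) \<cdot>\<^sub>v q (2 * l + 1)"
    and Modd: "M *\<^sub>v q (2 * l + 1) = cis (2 * \<theta> l) \<cdot>\<^sub>v q (2 * l)" if "l < n" for l
    using pairs that by auto
  \<comment> \<open>Passes from interleaved pairs to block order: first members of the pairs become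
    columns \<open>0\<close> to \<open>n - 1\<close>, their partners columns \<open>n\<close> to
    \<open>2 * n - 1\<close>.\<close>
  define h where "h j = (if j < n then 2 * j else 2 * (j - n) + 1)" for j
  have h: "h j < 2 * n" if "j < 2 * n" for j
    using that by (auto simp: h_def)
  have h_inj: "h i = h j \<longleftrightarrow> i = j" if "i < 2 * n" "j < 2 * n" for i j
    using that unfolding h_def by (auto split: if_splits) presburger+
  define RC where "RC = mat (2 * n) (2 * n) (\<lambda>(i, j). q (h j) $ i)"
  define R where "R = map_mat Re RC"
  have RC: "RC \<in> carrier_mat (2 * n) (2 * n)"
    by (simp add: RC_def)
  have col: "col RC j = q (h j)" if "j < 2 * n" for j
    using q(1)[OF h[OF that]] that by (auto simp: RC_def)
  have prod_smult: "q (h i) \<bullet> (c \<cdot>\<^sub>v q (h j)) = (if i = j then c else 0)" if "i < 2 * n" "j < 2 * n" for i j c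
    using that scalar_prod_smult_distrib[OF q(1)[OF h] q(1)[OF h]] ortho h h_inj by simp
  have RC_R: "map_mat complex_of_real R = RC"
  proof (rule eq_matI)
    fix i j assume "i < dim_row RC" "j < dim_col RC"
    then have ij: "i < 2 * n" "j < 2 * n"
      by (auto simp: RC_def)
    then have "map_vec cnj (q (h j)) $ i = cnj (q (h j) $ i)"
      using q(1)[OF h[OF ij(2)]] by simp
    then have "cnj (q (h j) $ i) = q (h j) $ i"
      using q(2)[OF h[OF ij(2)]] by simp
    then show "map_mat complex_of_real R $$ (i, j) = RC $$ (i, j)"
      using ij by (simp add: R_def RC_def complex_eq_iff)
  qed (auto simp: R_def)
  have "RC\<^sup>T * RC = 1\<^sub>m (2 * n)"
    using RC by (intro eq_matI) (auto simp: col ortho h h_inj)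
  then have "map_mat complex_of_real (R\<^sup>T * R) = map_mat complex_of_real (1\<^sub>m (2 * n))"
    using of_real_hom.mat_hom_mult[of "R\<^sup>T" "2 * n" "2 * n" R "2 * n", where ?'a = complex] RC RC_R
    by (simp add: R_def of_real_hom.mat_hom_one flip: map_mat_transpose)
  then have "R \<in> real_orthogonal_mats (2 * n)"
    using RC by (auto simp: real_orthogonal_mats_def R_def dest: of_real_hom.mat_hom_inj)
  moreover have "RC\<^sup>T * M * RC = phase_sympl n \<theta>"
  proof (rule eq_matI)
    fix i j assume "i < dim_row (phase_sympl n \<theta>)" "j < dim_col (phase_sympl n \<theta>)"
    then have ij: "i < 2 * n" "j < 2 * n"
      by (auto simp: phase_sympl_def mat_diag_def)
    have "(RC\<^sup>T * M * RC) $$ (i, j) = (RC\<^sup>T * (M * RC)) $$ (i, j)"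
      using RC M by (simp add: assoc_mult_mat[of _ "2 * n" "2 * n" _ "2 * n" _ "2 * n"])
    \<comment> \<open>By the pair relations, \<open>M\<close> sends column \<open>j\<close> to a
      multiple of column \<open>n + j\<close> or \<open>j - n\<close>, so orthonormality leaves a
      single nonzero entry per column.\<close>
    also have "\<dots> = q (h i) \<bullet> (M *\<^sub>v q (h j))"
      using RC M(1) ij col_mult2[OF M(1) RC ij(2)] by (simp add: col del: col_mult2)
    also have "\<dots> = phase_sympl n \<theta> $$ (i, j)"
    proof (cases "j < n")
      case True
      then have "2 * j + 1 = h (n + j)"
        by (simp add: h_def)
      then have "M *\<^sub>v q (h j) = (- cis (2 * \<theta> j)) \<cdot>\<^sub>v q (h (n + j))"
        using Meven[OF True] True by (simp add: h_def)
      with True ij show ?thesis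
        using prod_smult by (auto simp: phase_sympl_def mat_diag_def)
    next
      case False
      then have j: "j - n < n" "h j = 2 * (j - n) + 1" "h (j - n) = 2 * (j - n)"
        using ij by (auto simp: h_def)
      then have "M *\<^sub>v q (h j) = cis (2 * \<theta> (j - n)) \<cdot>\<^sub>v q (h (j - n))"
        using Modd[OF j(1)] by simp
      with False ij j(1) show ?thesis
        using prod_smult by (auto simp: phase_sympl_def mat_diag_def)
    qed
    finally show "(RC\<^sup>T * M * RC) $$ (i, j) = phase_sympl n \<theta> $$ (i, j)" .
  qed (use RC M in \<open>auto simp: phase_sympl_def mat_diag_def\<close>)
  ultimately show ?thesis
    using that \<theta> RC_R by blast
qed

lemma decomposition_exists:
  assumes U: "U \<in> complex_unitary_mats (2 * n)"
  shows "\<exists>R \<theta> Q. is_decomposition n U R \<theta> Q"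
proof -
  let ?m = "2 * n" and ?J = "sympl n" and ?U = "map_mat cnj U"
  note assoc = assoc_mult_mat[of _ ?m ?m _ ?m _ ?m]
  have Uc: "U \<in> carrier_mat ?m ?m" and unit: "mat_adjoint U * U = 1\<^sub>m ?m"
    using U by (auto simp: complex_unitary_mats_def)
  note U_ids = unitary_mat_identities[OF Uc unit]
  define M where "M = U * ?J * U\<^sup>T"
  have M: "M \<in> carrier_mat ?m ?m"
    unfolding M_def using Uc by (intro mult_carrier_mat[of _ ?m ?m _ ?m]) auto
  have anti: "M\<^sup>T = - M"
  proof -
    have "M\<^sup>T = U * (- ?J * U\<^sup>T)"
      unfolding M_def using Uc
      by (simp add: transpose_mult[of _ ?m ?m _ ?m] mult_carrier_mat[of _ ?m ?m _ ?m] sympl_transpose)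
    then show ?thesis
      unfolding M_def using Uc by (simp add: assoc mult_carrier_mat[of _ ?m ?m _ ?m])
  qed
  have M_unit: "map_mat cnj M * M = - 1\<^sub>m ?m"
  proof -
    have "map_mat cnj M = ?U * ?J * ?U\<^sup>T"
      unfolding M_def using Uc
      by (simp add: cnj.mat_hom_mult[of _ ?m ?m _ ?m] mult_carrier_mat[of _ ?m ?m _ ?m] map_cnj_sympl map_mat_transpose)
    \<comment> \<open>Regrouped so that the inner unitary factors cancel, then
      \<open>J J = -1\<close>, then the outer ones.\<close>
    then have "map_mat cnj M * M = ?U * (?J * (?U\<^sup>T * U) * ?J) * U\<^sup>T"
      unfolding M_def using Uc by (simp add: assoc mult_carrier_mat[of _ ?m ?m _ ?m])
    also have "\<dots> = - (?U * U\<^sup>T)"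
      using Uc by (simp add: U_ids sympl_square)
    finally show ?thesis
      by (simp add: U_ids)
  qed
  obtain R \<theta> where R: "R \<in> real_orthogonal_mats ?m" and \<theta>: "\<And>l. l < n \<Longrightarrow> \<theta> l \<in> {0..<pi / 2}"
    and form: "(map_mat complex_of_real R)\<^sup>T * M * map_mat complex_of_real R = phase_sympl n \<theta>"
    using antisymmetric_unitary_canonical_form[OF M anti M_unit] by blast
  define RC where "RC = map_mat complex_of_real R"
  have RC: "RC \<in> carrier_mat ?m ?m" and RC_real: "map_mat cnj RC = RC"
    using R by (auto simp: RC_def real_orthogonal_mats_def)
  have "RC\<^sup>T * RC = 1\<^sub>m ?m"
    using R of_real_hom.mat_hom_mult[of "R\<^sup>T" ?m ?m R ?m, where ?'a = complex]
    by (simp add: RC_def real_orthogonal_mats_def of_real_hom.mat_hom_one flip: map_mat_transpose)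
  then have RC_RT: "RC * RC\<^sup>T = 1\<^sub>m ?m"
    using RC by (intro mat_mult_left_right_inverse[of "RC\<^sup>T" ?m RC]) auto
  define P where "P = phase_block n \<theta>"
  define P' where "P' = map_mat cnj P"
  have P: "P \<in> carrier_mat ?m ?m" and P': "P' \<in> carrier_mat ?m ?m"
    by (auto simp: P_def P'_def)
  have PT: "P\<^sup>T = P" and P'T: "P'\<^sup>T = P'"
    by (simp_all add: P_def P'_def phase_block_transpose map_mat_transpose)
  have PP': "P * P' = 1\<^sub>m ?m"
    by (simp add: P_def P'_def phase_block_inverse)
  then have P'P: "P' * P = 1\<^sub>m ?m"
    by (rule mat_mult_left_right_inverse[OF P P'])
  \<comment> \<open>The choice is forced by \<open>U = RC P Q\<close>, because \<open>P'\<close>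
    inverts \<open>P\<close> and the transpose of \<open>RC\<close> inverts
    \<open>RC\<close>.\<close>
  define Q where "Q = P' * RC\<^sup>T * U"
  have Q: "Q \<in> carrier_mat ?m ?m"
    unfolding Q_def using P' RC Uc by (intro mult_carrier_mat[of _ ?m ?m _ ?m]) auto
  have QT: "Q\<^sup>T = U\<^sup>T * (RC * P')"
    unfolding Q_def using P' RC Uc
    by (simp add: transpose_mult[of _ ?m ?m _ ?m] mult_carrier_mat[of _ ?m ?m _ ?m] P'T)
  have "(map_mat cnj Q)\<^sup>T = map_mat cnj (Q\<^sup>T)"
    by (rule map_mat_transpose)
  also have "\<dots> = ?U\<^sup>T * (RC * P)"
    unfolding QT using P' RC Uc
    by (simp add: cnj.mat_hom_mult[of _ ?m ?m _ ?m] mult_carrier_mat[of _ ?m ?m _ ?m] RC_real map_mat_transpose)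
      (simp add: P'_def)
  finally have "mat_adjoint Q * Q = ?U\<^sup>T * (RC * (P * P') * RC\<^sup>T) * U"
    unfolding Q_def mat_adjoint_eq_transpose using P P' RC Uc
    by (simp add: assoc mult_carrier_mat[of _ ?m ?m _ ?m])
  then have "mat_adjoint Q * Q = 1\<^sub>m ?m"
    using RC Uc by (simp add: PP' RC_RT U_ids)
  moreover have "Q * ?J * Q\<^sup>T = ?J"
  proof -
    \<comment> \<open>The canonical form of \<open>M\<close> appears in the middle; written as
      \<open>P J P\<close>, it cancels against the outer factors \<open>P'\<close>.\<close>
    have "Q * ?J * Q\<^sup>T = P' * (RC\<^sup>T * M * RC) * P'"
      unfolding QT unfolding Q_def M_def using P' RC Uc
      by (simp add: assoc mult_carrier_mat[of _ ?m ?m _ ?m])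
    also have "\<dots> = P' * (P * ?J * P) * P'"
      using form by (simp add: RC_def P_def phase_block_sympl)
    also have "\<dots> = (P' * P) * ?J * (P * P')"
      using P P' by (simp add: assoc mult_carrier_mat[of _ ?m ?m _ ?m])
    finally show ?thesis
      by (simp add: PP' P'P)
  qed
  ultimately have "Q \<in> complexified_quat_unitary_mats n"
    using Q by (simp add: complexified_quat_unitary_iff complex_unitary_mats_def)
  moreover have "RC * P * Q = (RC * (P * P') * RC\<^sup>T) * U"
    unfolding Q_def using P P' RC Uc by (simp add: assoc mult_carrier_mat[of _ ?m ?m _ ?m])
  then have "U = RC * P * Q"
    using RC Uc by (simp add: PP' RC_RT)
  ultimately have "is_decomposition n U R \<theta> Q"
    using R \<theta> by (auto simp: is_decomposition_def RC_def P_def phase_block_def)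
  then show ?thesis by blast
qed

theorem theorem4p5:
  fixes n :: nat and U :: "complex mat"
  assumes "U \<in> complex_unitary_mats (2 * n)"
  shows "(\<exists>R \<theta> Q. is_decomposition n U R \<theta> Q) \<and>
    (\<forall>R \<theta> Q R' \<theta>' Q'.
       is_decomposition n U R \<theta> Q \<and> is_decomposition n U R' \<theta>' Q' \<longrightarrow>
       (\<exists>\<sigma>. \<sigma> permutes {..<n} \<and>
          (\<forall>l<n. phase_diag n \<theta>' $$ (l, l) = phase_diag n \<theta> $$ (\<sigma> l, \<sigma> l))))"
  using decomposition_exists[OF assms] decomposition_unique by blast

end
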